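(* The double Geronimus polynomials $\{P_n^{gg}(x)\}_{n\ge0}$ satisfy the three-term recurrence relation $$P_{n+1}^{gg}(x)=(x-a-\sigma_{n,n}^{gg})P_n^{gg}(x)-\sigma_{n,n-1}^{gg}P_{n-1}^{gg}(x),\qquad n\ge 0,$$ where $$\sigma_{n,n}^{gg}=B_n-B_{n+1}+(\beta_n-a)\qquad\text{and}\qquad \sigma_{n,n-1}^{gg}=\frac{C_n\lVert P_{n-2}\rVert_0^2}{C_{n-1}\lVert P_{n-3}\rVert_0^2}.$$
   Context: Let $\mu$ be a measure on the real line with support $E=\operatorname{supp}(\mu)$, and let $a\notin E$. Put $\langle p,q\rangle_0=\int_E p(x)q(x)\,d\mu(x)$ and $\lVert p\rVert_0^2=\langle p,p\rangle_0$. Let $\{P_n\}_{n\ge0}$ be the monic orthogonal polynomials with respect to $\mu$, satisfying $xP_n(x)=P_{n+1}(x)+\beta_nP_n(x)+\gamma_nP_{n-1}(x)$ for $n\ge 0$ (as usual, $P_{-1}=0$). Define $\mu_{gg}$ by $(x-a)^2\,d\mu_{gg}(x)=d\mu(x)$ and consider on real polynomials the Sobolev inner product $$\langle p,q\rangle_{gg}=\int_E p(x)q(x)\,d\mu_{gg}(x)+\begin{bmatrix}p(a)&p'(a)\end{bmatrix}\mathbf{M}_1\begin{bmatrix}q(a)\\ q'(a)\end{bmatrix},\qquad \mathbf{M}_1=\begin{bmatrix}b&c\\ c&d\end{bmatrix}-\begin{bmatrix}\int_E d\mu_{gg}(x)&\int_E x\,d\mu_{gg}(x)\\ \int_E x\,d\mu_{gg}(x)&\int_E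 x^2\,d\mu_{gg}(x)\end{bmatrix},$$ with constants $b,c,d$. It satisfies $\langle (x-a)^2p,q\rangle_{gg}=\langle p,q\rangle_0$. The double Geronimus polynomials $\{P_n^{gg}\}_{n\ge0}$ are the monic polynomials orthogonal with respect to $\langle\cdot,\cdot\rangle_{gg}$, with $\deg P_n^{gg}=n$ (and $P_{-1}^{gg}=0$). The constants $B_n,C_n$ are those in the expansion $P_n^{gg}(x)=P_n(x)+B_nP_{n-1}(x)+C_nP_{n-2}(x)$, $n\ge1$, with $C_n\ne0$ for $n\ge2$.
   Formalization: Adds d = ∫_E x² dμ_gg (lower right entry of M_1 is zero), since no three-term recurrence holds otherwise; sets B_0 = 0; for n = 1, 2, where the σ_{n,n-1} formula is undefined, the products C_j‖P_{j-2}‖² with j = 0, 1 are read as ⟨P_j^gg,P_j^gg⟩_gg. *)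

theory Defs
  imports "HOL-Analysis.Analysis" "HOL-Computational_Algebra.Polynomial"
begin

definition supp :: "real measure \<Rightarrow> real set" where
  "supp M = {x. \<forall>U. open U \<and> x \<in> U \<longrightarrow> emeasure M U > 0}"

definition ip0 :: "real measure \<Rightarrow> real poly \<Rightarrow> real poly \<Rightarrow> real" where
  "ip0 \<mu> p q = (LINT x:supp \<mu>|\<mu>. poly p x * poly q x)"

text \<open>The squared norm for \<open>ip0\<close>; the norm itself occurs only squared.\<close>

definition sqnorm0 :: "real measure \<Rightarrow> real poly \<Rightarrow> real" where
  "sqnorm0 \<mu> p = ip0 \<mu> p p"

definition M1 :: "real measure \<Rightarrow> real set \<Rightarrow> real \<Rightarrow> real \<Rightarrow> real \<Rightarrow> real^2^2" where
  "M1 \<nu> E b c d =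
     vector [vector [b, c], vector [c, d]]
     - vector [vector [LINT x:E|\<nu>. 1, LINT x:E|\<nu>. x],
               vector [LINT x:E|\<nu>. x, LINT x:E|\<nu>. x^2]]"

text \<open>
  Here \<open>\<nu>\<close> plays the role of \<open>\<mu>\<^sub>g\<^sub>g\<close>, and \<open>E\<close> is the support of the original measure \<open>\<mu>\<close>.
  Multiplication by \<open>x\<close> satisfies
  \<open>ip_gg (x p) q - ip_gg p (x q) = m * (p(a) q'(a) - p'(a) q(a))\<close>,
  where \<open>m = d - (LINT x:E|\<nu>. x^2)\<close> is the lower right entry of the matrix \<open>M1\<close>.
  So a three-term recurrence is available only for \<open>m = 0\<close>: this is the one constraint on
  \<open>b\<close>, \<open>c\<close>, \<open>d\<close> that the theorem needs.
\<close>

definition ip_gg ::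
  "real measure \<Rightarrow> real set \<Rightarrow> real \<Rightarrow> real \<Rightarrow> real \<Rightarrow> real \<Rightarrow> real poly \<Rightarrow> real poly \<Rightarrow> real" where
  "ip_gg \<nu> E a b c d p q =
     (LINT x:E|\<nu>. poly p x * poly q x)
     + (vector [poly p a, poly (pderiv p) a] :: real^2)
         \<bullet> (M1 \<nu> E b c d *v vector [poly q a, poly (pderiv q) a])"

text \<open>The form is not required to be positive definite, only nondegenerate on each \<open>P n\<close>.\<close>

definition monic_orthogonal ::
  "(real poly \<Rightarrow> real poly \<Rightarrow> real) \<Rightarrow> (nat \<Rightarrow> real poly) \<Rightarrow> bool" where
  "monic_orthogonal ip P \<longleftrightarrow>
     (\<forall>n. degree (P n) = n \<and> lead_coeff (P n) = 1) \<and>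
     (\<forall>m n. m \<noteq> n \<longrightarrow> ip (P m) (P n) = 0) \<and>
     (\<forall>n. ip (P n) (P n) \<noteq> 0)"

text \<open>Extension of a sequence to negative indices by zero, so that \<open>P\<^sub>-\<^sub>1 = P\<^sub>-\<^sub>2 = 0\<close>.\<close>

definition idx :: "(nat \<Rightarrow> real poly) \<Rightarrow> int \<Rightarrow> real poly" where
  "idx P k = (if k < 0 then 0 else P (nat k))"

definition sigma_diag :: "(nat \<Rightarrow> real) \<Rightarrow> (nat \<Rightarrow> real) \<Rightarrow> real \<Rightarrow> nat \<Rightarrow> real" where
  "sigma_diag B \<beta> a n = B n - B (n + 1) + (\<beta> n - a)"

text \<open>
  The quantity \<open>C\<^sub>n \<parallel>P\<^sub>n\<^sub>-\<^sub>2\<parallel>\<^sup>2\<close>. For \<open>n \<ge> 2\<close> it equals \<open>\<langle>P\<^sub>n\<^sup>g\<^sup>g, P\<^sub>n\<^sup>g\<^sup>g\<rangle>\<close>, because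
  \<open>\<langle>P\<^sub>n\<^sup>g\<^sup>g, (x - a)\<^sup>2 P\<^sub>n\<^sub>-\<^sub>2\<rangle> = \<langle>P\<^sub>n\<^sup>g\<^sup>g, P\<^sub>n\<^sub>-\<^sub>2\<rangle>\<^sub>0\<close>. For \<open>n = 0\<close> and \<open>n = 1\<close> the product has a negative
  index and is read as that squared norm; literally it would make the quotient \<open>sigma_sub\<close>
  an undefined expression for \<open>n = 1\<close> and \<open>n = 2\<close>.
\<close>

definition C_sqnorm ::
  "(real poly \<Rightarrow> real poly \<Rightarrow> real) \<Rightarrow> real measure \<Rightarrow> (nat \<Rightarrow> real poly) \<Rightarrow> (nat \<Rightarrow> real poly)
    \<Rightarrow> (nat \<Rightarrow> real) \<Rightarrow> nat \<Rightarrow> real" where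
  "C_sqnorm ip \<mu> P Pgg C n =
     (if 2 \<le> n then C n * sqnorm0 \<mu> (P (n - 2)) else ip (Pgg n) (Pgg n))"

text \<open>At \<open>n = 0\<close> the value is immaterial: the coefficient multiplies \<open>P\<^sub>-\<^sub>1\<^sup>g\<^sup>g = 0\<close>.\<close>

definition sigma_sub ::
  "(real poly \<Rightarrow> real poly \<Rightarrow> real) \<Rightarrow> real measure \<Rightarrow> (nat \<Rightarrow> real poly) \<Rightarrow> (nat \<Rightarrow> real poly)
    \<Rightarrow> (nat \<Rightarrow> real) \<Rightarrow> nat \<Rightarrow> real" where
  "sigma_sub ip \<mu> P Pgg C n = C_sqnorm ip \<mu> P Pgg C n / C_sqnorm ip \<mu> P Pgg C (n - 1)"

end

theory Submission
  imports Defs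
begin

text \<open>
  A three-term recurrence holds for the monic orthogonal polynomials of every symmetric bilinear
  form for which multiplication by \<open>x\<close> is symmetric. The reason is that \<open>x P\<^sub>n\<close> is orthogonal to
  \<open>P\<^sub>k\<close> for \<open>k < n - 1\<close>, since \<open>x P\<^sub>k\<close> has degree below \<open>n\<close>. The coefficient of \<open>P\<^sub>n\<close> is found
  by comparing the coefficients of \<open>x\<^sup>n\<close>, and the coefficient of \<open>P\<^sub>n\<^sub>-\<^sub>1\<close> is the quotient of two
  consecutive squared norms
  (\<open>three_term_recurrence\<close>).

  The Sobolev form is of this kind (\<open>moment_form_ip_gg\<close>): the measure part is so trivially, and in
  the discrete part the only term that does not commute with multiplication by \<open>x\<close> is the one in
  \<open>p'(a) q'(a)\<close>, whose coefficient \<open>d - \<integral>x\<^sup>2 d\<mu>\<^sub>g\<^sub>g\<close> is zero. The integrals exist because \<open>a\<close> has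
  positive distance to the closed set \<open>E\<close>, so that \<open>(x - a)\<^sup>-\<^sup>2\<close> is bounded there.

  It remains to read off the two coefficients. The second highest coefficients of \<open>P\<^sub>n\<close> and
  \<open>P\<^sub>n\<^sup>g\<^sup>g\<close> differ by \<open>B\<^sub>n\<close>, and the successive differences of those of \<open>P\<^sub>n\<close> are the \<open>\<beta>\<^sub>n\<close>; this
  gives the diagonal coefficient. The squared norms come from the connection between the two forms
  (\<open>ip_gg_square_factor\<close>): for \<open>n \<ge> 2\<close>, \<open>P\<^sub>n\<^sup>g\<^sup>g\<close> has the same product with itself as with
  \<open>(x - a)\<^sup>2 P\<^sub>n\<^sub>-\<^sub>2\<close>, which is the \<open>\<mu>\<close>-product of \<open>P\<^sub>n\<^sup>g\<^sup>g\<close> and \<open>P\<^sub>n\<^sub>-\<^sub>2\<close>, that is,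
  \<open>C\<^sub>n \<parallel>P\<^sub>n\<^sub>-\<^sub>2\<parallel>\<^sup>2\<close>.
\<close>

section \<open>Orthogonal polynomials of a form that commutes with multiplication by the variable\<close>

text \<open>
  These are the Hankel forms \<open>(p, q) \<mapsto> L (p q)\<close> of linear functionals \<open>L\<close> on polynomials, where
  \<open>L p = ip p 1\<close>.
\<close>

locale moment_form =
  fixes ip :: "real poly \<Rightarrow> real poly \<Rightarrow> real"
  assumes commute: "ip p q = ip q p"
    and add_left: "ip (p + q) r = ip p r + ip q r"
    and smult_left: "ip (smult k p) r = k * ip p r"
    and shift: "ip ([:0, 1:] * p) q = ip p ([:0, 1:] * q)"
begin

lemma zero_left: "ip 0 q = 0"
  using smult_left[of 0 0 q] by simp

lemma diff_left: "ip (p - q) r = ip p r - ip q r"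
  using add_left[of "p - q" q r] by simp

end

lemma monic_orthogonal_degree: "monic_orthogonal ip P \<Longrightarrow> degree (P n) = n"
  unfolding monic_orthogonal_def by blast

lemma monic_orthogonal_lead: "coeff (P n) n = 1" if P: "monic_orthogonal ip P"
proof -
  have "lead_coeff (P n) = 1" using P unfolding monic_orthogonal_def by blast
  then show ?thesis by (simp only: monic_orthogonal_degree[OF P])
qed

lemma monic_orthogonal_ortho: "monic_orthogonal ip P \<Longrightarrow> m \<noteq> n \<Longrightarrow> ip (P m) (P n) = 0"
  unfolding monic_orthogonal_def by blast

lemma monic_orthogonal_norm: "monic_orthogonal ip P \<Longrightarrow> ip (P n) (P n) \<noteq> 0"
  unfolding monic_orthogonal_def by blast

lemma monic_orthogonal_coeff_above: "monic_orthogonal ip P \<Longrightarrow> n < k \<Longrightarrow> coeff (P n) k = 0"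
  using monic_orthogonal_degree[of ip P n] coeff_eq_0[of "P n" k] by (simp only:)

context moment_form
begin

lemma ip_lower_degree:
  assumes P: "monic_orthogonal ip P" and "\<forall>k\<ge>n. coeff q k = 0"
  shows "n \<le> m \<Longrightarrow> ip q (P m) = 0"
  using assms(2)
proof (induction n arbitrary: q)
  case 0
  then have "q = 0" by (simp add: poly_eq_iff)
  then show ?case by (simp add: zero_left)
next
  case (Suc n)
  \<comment> \<open>Subtracting the right multiple of \<open>P n\<close> removes the highest coefficient.\<close>
  let ?r = "q - smult (coeff q n) (P n)"
  have "\<forall>k\<ge>n. coeff ?r k = 0"
  proof (intro allI impI)
    fix k assume "n \<le> k"
    then show "coeff ?r k = 0"
      using Suc.prems P monic_orthogonal_lead[OF P] monic_orthogonal_coeff_above[OF P]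
      by (cases "k = n") auto
  qed
  then have "ip ?r (P m) = 0"
    using Suc.IH Suc_leD Suc.prems(1) by blast
  moreover have "ip (P n) (P m) = 0"
    using Suc.prems monic_orthogonal_ortho[OF P] by simp
  ultimately show ?case by (simp add: diff_left smult_left)
qed

lemma ip_leading_coeff:
  assumes P: "monic_orthogonal ip P" and "degree q \<le> n"
  shows "ip q (P n) = coeff q n * ip (P n) (P n)"
proof -
  let ?r = "q - smult (coeff q n) (P n)"
  have "coeff ?r k = 0" if "n \<le> k" for k
    using that assms(2) monic_orthogonal_lead[OF P] monic_orthogonal_coeff_above[OF P]
    by (cases "k = n") (auto simp: coeff_eq_0)
  then have "ip ?r (P n) = 0"
    using ip_lower_degree[OF P] by blast
  then show ?thesis by (simp add: diff_left smult_left)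
qed

text \<open>
  The form is nondegenerate on polynomials of bounded degree: a nonzero polynomial of degree \<open>k\<close>
  has a nonzero product with \<open>P k\<close>.
\<close>

lemma eq_0_if_orthogonal:
  assumes P: "monic_orthogonal ip P" and low: "\<forall>k\<ge>n. coeff q k = 0"
    and ortho: "\<And>k. k < n \<Longrightarrow> ip q (P k) = 0"
  shows "q = 0"
proof (rule ccontr)
  assume "q \<noteq> 0"
  then have lc: "coeff q (degree q) \<noteq> 0" by simp
  with low have "degree q < n" using linorder_not_less by blast
  with ortho ip_leading_coeff[OF P order_refl, of q] lc monic_orthogonal_norm[OF P]
  show False by simp
qed

text \<open>
  The coefficient of \<open>x\<^sup>n\<^sup>-\<^sup>1\<close> in \<open>P n\<close> appears as the coefficient of \<open>x\<^sup>n\<close> in \<open>x P n\<close>, which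
  is the right value 0 for \<open>n = 0\<close>.
\<close>

theorem three_term_recurrence:
  assumes P: "monic_orthogonal ip P"
  shows "[:0, 1:] * P n = P (n + 1)
    + smult (coeff ([:0, 1:] * P n) n - coeff ([:0, 1:] * P (n + 1)) (n + 1)) (P n)
    + smult (ip (P n) (P n) / ip (P (n - 1)) (P (n - 1))) (idx P (int n - 1))"
proof -
  define s where "s = coeff ([:0, 1:] * P n) n - coeff ([:0, 1:] * P (n + 1)) (n + 1)"
  define t where "t = ip (P n) (P n) / ip (P (n - 1)) (P (n - 1))"
  define R where "R = [:0, 1:] * P n - P (n + 1) - smult s (P n) - smult t (idx P (int n - 1))"
  have idx: "idx P (int n - 1) = (if n = 0 then 0 else P (n - 1))"
    by (simp add: idx_def nat_diff_distrib)
  have "R = 0"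
  proof (rule eq_0_if_orthogonal[OF P])
    \<comment> \<open>The leading terms cancel, and \<open>s\<close> is chosen to cancel the coefficient of \<open>x\<^sup>n\<close>.\<close>
    show "\<forall>k\<ge>n. coeff R k = 0"
    proof (intro allI impI)
      fix k assume "n \<le> k"
      then consider "k = n" | "k = Suc n" | "Suc n < k" by linarith
      then show "coeff R k = 0"
        by cases (auto simp: R_def s_def idx monic_orthogonal_lead[OF P]
            monic_orthogonal_coeff_above[OF P] coeff_pCons split: nat.split)
    qed
  next
    fix k assume k: "k < n"
    then have zero: "ip (P n) (P k) = 0" "ip (P (n + 1)) (P k) = 0"
      using monic_orthogonal_ortho[OF P] by simp_all
    have "ip ([:0, 1:] * P n) (P k) = ip ([:0, 1:] * P k) (P n)"
      using shift commute by simp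
    also have "\<dots> = coeff ([:0, 1:] * P k) n * ip (P n) (P n)"
    proof (rule ip_leading_coeff[OF P])
      show "degree ([:0, 1:] * P k) \<le> n"
        using k monic_orthogonal_degree[OF P, of k] degree_pCons_le[of 0 "P k"] by simp
    qed
    also have "\<dots> = t * ip (P (n - 1)) (P k)"
    proof (cases "k = n - 1")
      case True
      then have "coeff ([:0, 1:] * P k) n = 1"
        using k monic_orthogonal_lead[OF P] by (cases n) simp_all
      with True show ?thesis
        using monic_orthogonal_norm[OF P] by (simp add: t_def)
    next
      case False
      then have "coeff ([:0, 1:] * P k) n = 0"
        using k monic_orthogonal_coeff_above[OF P] by (cases n) simp_all
      with False show ?thesis
        using monic_orthogonal_ortho[OF P] by simp
    qed
    finally show "ip R (P k) = 0"
      using k zero by (simp add: R_def idx diff_left smult_left del: mult_pCons_left)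
  qed
  then have "[:0, 1:] * P n = P (n + 1) + smult s (P n) + smult t (idx P (int n - 1))"
    unfolding R_def by (simp only: diff_eq_eq add_0 add.commute add.left_commute)
  then show ?thesis by (simp only: s_def t_def)
qed

end

section \<open>The two inner products\<close>

lemma set_integrable_poly:
  fixes p :: "real poly"
  assumes "\<And>k. set_integrable M E (\<lambda>x. x ^ k)"
  shows "set_integrable M E (poly p)"
proof -
  have "set_integrable M E (\<lambda>x. coeff p k * x ^ k)" for k
    using assms by simp
  then have "integrable M (\<lambda>x. \<Sum>k\<le>degree p. indicator E x *\<^sub>R (coeff p k * x ^ k))"
    unfolding set_integrable_def by (rule Bochner_Integration.integrable_sum)
  then show ?thesis
    unfolding set_integrable_def poly_altdef scaleR_sum_right .
qed

lemma moment_form_set_integral: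
  assumes "\<And>k. set_integrable M E (\<lambda>x. x ^ k)"
  shows "moment_form (\<lambda>p q. LINT x:E|M. poly p x * poly q x)"
proof
  fix p q r :: "real poly" and k :: real
  have int: "set_integrable M E (\<lambda>x. poly p x * poly q x)" for p q
    using set_integrable_poly[OF assms, of "p * q"] by (simp add: poly_mult[abs_def])
  show "(LINT x:E|M. poly p x * poly q x) = (LINT x:E|M. poly q x * poly p x)"
    by (simp add: mult.commute)
  show "(LINT x:E|M. poly (p + q) x * poly r x)
      = (LINT x:E|M. poly p x * poly r x) + (LINT x:E|M. poly q x * poly r x)"
    using set_integral_add(2)[OF int int] by (simp add: distrib_right)
  show "(LINT x:E|M. poly (smult k p) x * poly r x) = k * (LINT x:E|M. poly p x * poly r x)"
    by (simp add: mult.assoc)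
  show "(LINT x:E|M. poly ([:0, 1:] * p) x * poly q x)
      = (LINT x:E|M. poly p x * poly ([:0, 1:] * q) x)"
    by (simp add: mult_ac)
qed

lemma ip_gg_expand:
  "ip_gg \<nu> E a b c d p q = (LINT x:E|\<nu>. poly p x * poly q x)
     + (b - (LINT x:E|\<nu>. 1)) * poly p a * poly q a
     + (c - (LINT x:E|\<nu>. x)) * (poly p a * poly (pderiv q) a + poly (pderiv p) a * poly q a)
     + (d - (LINT x:E|\<nu>. x\<^sup>2)) * poly (pderiv p) a * poly (pderiv q) a"
  by (simp add: ip_gg_def M1_def inner_vec_def sum_2 matrix_vector_mult_def algebra_simps)

text \<open>
  Both \<open>p(a) q(a)\<close> and \<open>(p q)'(a)\<close> depend on the product \<open>p q\<close> only, hence commute with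
  multiplication by \<open>x\<close>; the product \<open>p'(a) q'(a)\<close> has the coefficient 0.
\<close>

lemma moment_form_ip_gg:
  assumes int: "\<And>k. set_integrable \<nu> E (\<lambda>x. x ^ k)" and d: "d = (LINT x:E|\<nu>. x\<^sup>2)"
  shows "moment_form (ip_gg \<nu> E a b c d)"
proof -
  interpret I: moment_form "\<lambda>p q. LINT x:E|\<nu>. poly p x * poly q x"
    by (rule moment_form_set_integral[OF int])
  show ?thesis
  proof
    fix p q r :: "real poly" and k :: real
    show "ip_gg \<nu> E a b c d p q = ip_gg \<nu> E a b c d q p"
      unfolding ip_gg_expand I.commute[of p q] by (simp add: d algebra_simps)
    show "ip_gg \<nu> E a b c d (p + q) r = ip_gg \<nu> E a b c d p r + ip_gg \<nu> E a b c d q r"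
      unfolding ip_gg_expand I.add_left by (simp add: d pderiv_add algebra_simps)
    show "ip_gg \<nu> E a b c d (smult k p) r = k * ip_gg \<nu> E a b c d p r"
      unfolding ip_gg_expand I.smult_left by (simp add: d pderiv_smult algebra_simps)
    show "ip_gg \<nu> E a b c d ([:0, 1:] * p) q = ip_gg \<nu> E a b c d p ([:0, 1:] * q)"
      unfolding ip_gg_expand I.shift by (simp add: d pderiv_pCons algebra_simps)
  qed
qed

lemma closed_supp: "closed (supp M)"
proof -
  have "- supp M = \<Union>{U. open U \<and> \<not> emeasure M U > 0}"
    by (auto simp: supp_def)
  then have "open (- supp M)" by auto
  then show ?thesis by (simp add: closed_def)
qed

text \<open>
  On \<open>E\<close>, \<open>\<nu>\<close> has the density \<open>(x - a)\<^sup>-\<^sup>2\<close> with respect to \<open>\<mu>\<close>, and this density is bounded by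
  \<open>e\<^sup>-\<^sup>2\<close> if \<open>e\<close> is the radius of a ball around \<open>a\<close> outside \<open>E\<close>. Off \<open>E\<close> nothing can be said:
  an atom of \<open>\<nu>\<close> at \<open>a\<close>, even of infinite mass, leaves no trace in \<open>\<mu>\<close>.
\<close>

lemma set_integrable_power_geronimus:
  fixes \<mu> \<nu> :: "real measure"
  assumes borel: "sets \<mu> = sets borel" and moments: "\<And>k. integrable \<mu> (\<lambda>x. x ^ k)"
    and E: "closed E" "a \<notin> E" and \<nu>: "density \<nu> (\<lambda>x. ennreal ((x - a)\<^sup>2)) = \<mu>"
  shows "set_integrable \<nu> E (\<lambda>x. x ^ k)"
proof -
  have sets: "sets \<nu> = sets borel"
    using \<nu> borel sets_density by metis
  note meas [measurable_cong] = borel sets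
  have Em [measurable]: "E \<in> sets borel" using E by simp
  obtain e where e: "e > 0" "ball a e \<subseteq> - E"
    using E open_contains_ball[of "- E"] by (auto simp: closed_def)
  define g where "g x = indicator E x * (x ^ k / (x - a)\<^sup>2)" for x :: real
  have g [measurable]: "g \<in> borel_measurable borel"
    unfolding g_def by measurable
  have "integrable \<mu> (\<lambda>x. x ^ k / e\<^sup>2)" using moments by simp
  then have "integrable \<mu> g"
  proof (rule Bochner_Integration.integrable_bound)
    show "g \<in> borel_measurable \<mu>" by measurable
    have "norm (g x) \<le> norm (x ^ k / e\<^sup>2)" for x
    proof (cases "x \<in> E")
      case True
      with e have "e \<le> \<bar>x - a\<bar>" by (force simp: dist_real_def abs_minus_commute)
      with e have "e\<^sup>2 \<le> (x - a)\<^sup>2" by (metis abs_le_square_iff abs_of_pos)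
      with e True show ?thesis by (auto simp: g_def intro!: divide_left_mono mult_pos_pos)
    qed (simp add: g_def)
    then show "AE x in \<mu>. norm (g x) \<le> norm (x ^ k / e\<^sup>2)" by simp
  qed
  then have "integrable \<nu> (\<lambda>x. (x - a)\<^sup>2 *\<^sub>R g x)"
    unfolding \<nu>[symmetric] by (subst (asm) integrable_density) simp_all
  moreover have "(\<lambda>x. (x - a)\<^sup>2 *\<^sub>R g x) = (\<lambda>x. indicator E x *\<^sub>R x ^ k)"
    using E by (auto simp: g_def indicator_def fun_eq_iff)
  ultimately show ?thesis by (simp add: set_integrable_def)
qed

lemma ip_gg_square_factor:
  fixes \<mu> \<nu> :: "real measure"
  assumes borel: "sets \<mu> = sets borel" and \<nu>: "density \<nu> (\<lambda>x. ennreal ((x - a)\<^sup>2)) = \<mu>"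
  shows "ip_gg \<nu> (supp \<mu>) a b c d ([:- a, 1:]\<^sup>2 * p) q = ip0 \<mu> p q"
proof -
  have sets: "sets \<nu> = sets borel"
    using \<nu> borel sets_density by metis
  note meas [measurable_cong] = borel sets
  have [measurable]: "supp \<mu> \<in> sets borel" using closed_supp by simp
  have [measurable]: "poly r \<in> borel_measurable borel" for r :: "real poly"
    by (intro borel_measurable_continuous_onI continuous_intros)
  define g where "g x = indicator (supp \<mu>) x * (poly p x * poly q x)" for x
  have [measurable]: "g \<in> borel_measurable borel" unfolding g_def by measurable
  have "ip0 \<mu> p q = (LINT x|density \<nu> (\<lambda>x. ennreal ((x - a)\<^sup>2)). g x)"
    by (simp add: ip0_def set_lebesgue_integral_def g_def \<nu>)
  also have "\<dots> = (LINT x|\<nu>. (x - a)\<^sup>2 *\<^sub>R g x)"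
    by (rule integral_density) simp_all
  also have "\<dots> = (LINT x:supp \<mu>|\<nu>. poly ([:- a, 1:]\<^sup>2 * p) x * poly q x)"
    by (simp add: set_lebesgue_integral_def g_def power2_eq_square algebra_simps)
  also have "\<dots> = ip_gg \<nu> (supp \<mu>) a b c d ([:- a, 1:]\<^sup>2 * p) q"
    \<comment> \<open>\<open>[:- a, 1:]\<^sup>2 * p\<close> has a double zero at \<open>a\<close>, so the discrete part vanishes.\<close>
    by (simp add: ip_gg_expand pderiv_mult pderiv_power_Suc numeral_2_eq_2 pderiv_pCons
        del: mult_pCons_left)
  finally show ?thesis by simp
qed

section \<open>The recurrence of the double Geronimus polynomials\<close>

theorem theorem2p1:
  fixes \<mu> \<mu>gg :: "real measure" and E :: "real set" and a b c d :: real
    and P Pgg :: "nat \<Rightarrow> real poly" and \<beta> \<gamma> B C :: "nat \<Rightarrow> real"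
  assumes borel: "sets \<mu> = sets borel"
    and moments: "\<And>k. integrable \<mu> (\<lambda>x. x ^ k)"
    and supp: "E = supp \<mu>"
    and a: "a \<notin> E"
    and P: "monic_orthogonal (ip0 \<mu>) P"
    and recurrence: "\<And>n. [:0, 1:] * P n
          = P (n + 1) + smult (\<beta> n) (P n) + smult (\<gamma> n) (idx P (int n - 1))"
    and \<mu>gg: "density \<mu>gg (\<lambda>x. ennreal ((x - a)\<^sup>2)) = \<mu>"
    and Pgg: "monic_orthogonal (ip_gg \<mu>gg E a b c d) Pgg"
    and d: "d = (LINT x:E|\<mu>gg. x\<^sup>2)"
    and expansion: "\<And>n. n \<ge> 1 \<Longrightarrow> Pgg n
          = P n + smult (B n) (idx P (int n - 1)) + smult (C n) (idx P (int n - 2))"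
    and B_0: "B 0 = 0"
    and C_nonzero: "\<And>n. n \<ge> 2 \<Longrightarrow> C n \<noteq> 0"
  shows "\<forall>n. Pgg (n + 1)
          = [:- a - sigma_diag B \<beta> a n, 1:] * Pgg n
            - smult (sigma_sub (ip_gg \<mu>gg E a b c d) \<mu> P Pgg C n) (idx Pgg (int n - 1))"
proof
  fix n
  let ?gg = "ip_gg \<mu>gg E a b c d"
  have E: "closed E" using supp closed_supp by simp
  have "set_integrable \<mu> E (\<lambda>x. x ^ k)" for k
    unfolding set_integrable_def
    by (rule integrable_mult_indicator) (use E moments borel in simp_all)
  then interpret I0: moment_form "ip0 \<mu>"
    using moment_form_set_integral[of \<mu> "supp \<mu>"] supp by (simp add: ip0_def[abs_def])
  interpret G: moment_form ?gg
    using set_integrable_power_geronimus[OF borel moments E a \<mu>gg] d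
    by (intro moment_form_ip_gg)
  have norm_gg: "C_sqnorm ?gg \<mu> P Pgg C m = ?gg (Pgg m) (Pgg m)" for m
  proof (cases "2 \<le> m")
    case True
    define k where "k = m - 2"
    have m: "m = k + 2" using True by (simp add: k_def)
    let ?q = "[:- a, 1:]\<^sup>2 * P k"
    have Pk: "degree (P k) = k" "lead_coeff (P k) = 1"
      by (simp_all add: monic_orthogonal_degree[OF P] monic_orthogonal_lead[OF P])
    then have q: "degree ?q = m" "coeff ?q m = 1"
    proof -
      show deg: "degree ?q = m"
        using Pk m by (subst degree_mult_eq) (auto simp: degree_power_eq)
      have "lead_coeff ?q = 1"
        using Pk by (simp add: lead_coeff_mult lead_coeff_power del: mult_pCons_left)
      with deg show "coeff ?q m = 1" by simp
    qed
    then have "?gg (Pgg m) (Pgg m) = ?gg ?q (Pgg m)"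
      using G.ip_leading_coeff[OF Pgg, of ?q m] by simp
    also have "\<dots> = ip0 \<mu> (Pgg m) (P k)"
      using ip_gg_square_factor[OF borel \<mu>gg] I0.commute supp by simp
    also have "\<dots> = C m * sqnorm0 \<mu> (P k)"
      using expansion[of m] m monic_orthogonal_ortho[OF P]
      by (simp add: idx_def nat_add_distrib I0.add_left I0.smult_left sqnorm0_def)
    finally show ?thesis using True by (simp add: C_sqnorm_def k_def)
  qed (simp add: C_sqnorm_def)
  have \<beta>: "\<beta> k = coeff ([:0, 1:] * P k) k - coeff ([:0, 1:] * P (k + 1)) (k + 1)" for k
  proof -
    have "coeff (idx P (int k - 1)) k = 0"
      using monic_orthogonal_coeff_above[OF P] by (simp add: idx_def nat_diff_distrib)
    then show ?thesis
      using monic_orthogonal_lead[OF P, of k] arg_cong[OF recurrence[of k], of "\<lambda>p. coeff p k"]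
      by simp
  qed
  have B: "coeff ([:0, 1:] * Pgg k) k = coeff ([:0, 1:] * P k) k + B k" for k
  proof (cases k)
    case 0
    then show ?thesis by (simp add: B_0)
  next
    case (Suc j)
    have "coeff (idx P (int j - 1)) j = 0"
      using monic_orthogonal_coeff_above[OF P] by (simp add: idx_def nat_diff_distrib)
    with Suc show ?thesis
      using expansion[of k] monic_orthogonal_lead[OF P, of j] by (simp add: idx_def)
  qed
  have diag: "coeff ([:0, 1:] * Pgg n) n - coeff ([:0, 1:] * Pgg (n + 1)) (n + 1)
      = a + sigma_diag B \<beta> a n"
    unfolding B sigma_diag_def \<beta> by simp
  have sub: "?gg (Pgg n) (Pgg n) / ?gg (Pgg (n - 1)) (Pgg (n - 1)) = sigma_sub ?gg \<mu> P Pgg C n"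
    by (simp add: sigma_sub_def norm_gg)
  have "[:0, 1:] * Pgg n = Pgg (n + 1) + smult (a + sigma_diag B \<beta> a n) (Pgg n)
      + smult (sigma_sub ?gg \<mu> P Pgg C n) (idx Pgg (int n - 1))"
    using G.three_term_recurrence[OF Pgg, of n] unfolding diag sub .
  moreover have "[:- a - sigma_diag B \<beta> a n, 1:] * Pgg n
      = [:0, 1:] * Pgg n - smult (a + sigma_diag B \<beta> a n) (Pgg n)"
    by (simp add: smult_add_left smult_diff_left)
  ultimately show "Pgg (n + 1) = [:- a - sigma_diag B \<beta> a n, 1:] * Pgg n
      - smult (sigma_sub ?gg \<mu> P Pgg C n) (idx Pgg (int n - 1))"
    by simp
qed

end
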